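(* Suppose that for every $\boldsymbol{\lambda}\in\Lambda$, all optimal basic feasible solutions of the linear program defining $c(\boldsymbol{\lambda})$ are nondegenerate. Then $c$ is weakly concave on $\Lambda$.
   Context: Fix an integer $N\ge 1$ and write $[N]=\{1,\dots,N\}$. Costs $c_{(i)}>0$ and $c_{(i,j)}>0$ ($i,j\in[N]$) are given with $c_{(i)}=c_{(i,i)}\le c_{(i,j)}=c_{(j,i)}$ for all $i,j\in[N]$. The parameters $\theta_i\ge 0$ ($i\in[N]$) are given. The domain is the box $\Lambda=[\underline{\boldsymbol{\lambda}},\overline{\boldsymbol{\lambda}}]=\{\boldsymbol{\lambda}\in\mathbb{R}^N:\underline{\lambda}_i\le\lambda_i\le\overline{\lambda}_i\ \forall i\}$ with $\underline{\lambda}_i>0$ for all $i$. For $\boldsymbol{\lambda}\in\Lambda$, $c(\boldsymbol{\lambda})$ is the optimal value of the linear program in variables $\boldsymbol{x}=(x_{i,j})_{i,j\in[N]}$, $\boldsymbol{y}=(y_i)_{i\in[N]}$: minimize $\sum_{i,j\in[N]}c_{(i,j)}x_{i,j}+\sum_{i\in[N]}c_{(i)}y_i$ subject to $\sum_{j\in[N]}x_{j,i}+\sum_{j\in[N]}x_{i,j}+y_i=\lambda_i$ for all $i\in[N]$; $\theta_i x_{i,j}\le\lambda_j y_i$ for all $i,j\in[N]$; $x_{i,j}\ge 0$ for all $i,j\in[N]$; $y_i\ge 0$ for all $i\in[N]$. Basic feasible solutions are understood for the standard form of this program obtained by adding slack variables $\delta_{i,j}\ge 0$ and writing $\theta_i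 x_{i,j}+\delta_{i,j}=\lambda_j y_i$ for all $i,j\in[N]$; it has $2N^2+N$ nonnegative variables and $N^2+N$ linearly independent equality constraints. A basic feasible solution is nondegenerate if all $N^2+N$ basic variables are strictly positive (equivalently, exactly $N^2$ variables are zero). Weak concavity: $c$ is weakly concave on $\Lambda$ if there exists a finite $\rho\ge 0$ such that $\boldsymbol{\lambda}\mapsto c(\boldsymbol{\lambda})-\rho\|\boldsymbol{\lambda}\|^2/2$ is concave on $\Lambda$, with $\|\cdot\|$ the Euclidean norm. *)

theory Defs
  imports "HOL-Analysis.Analysis"
begin

subsection \<open>Linear programs in standard form: minimize \<open>q \<bullet> z\<close> subject to \<open>A *v z = b\<close>, \<open>z \<ge> 0\<close>\<close>

definition std_feasible :: "real^'v^'m \<Rightarrow> real^'m \<Rightarrow> real^'v \<Rightarrow> bool" where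
  "std_feasible A b z \<longleftrightarrow> A *v z = b \<and> (\<forall>v. 0 \<le> z $ v)"

text \<open>Injectivity is needed because \<^const>\<open>independent\<close> speaks about the set of columns,
  not about the indexed family.\<close>

definition lp_basis :: "real^'v^'m \<Rightarrow> 'v set \<Rightarrow> bool" where
  "lp_basis A B \<longleftrightarrow>
     card B = CARD('m) \<and> inj_on (\<lambda>v. column v A) B \<and> independent ((\<lambda>v. column v A) ` B)"

definition basic_solution_for :: "real^'v^'m \<Rightarrow> 'v set \<Rightarrow> real^'v \<Rightarrow> bool" where
  "basic_solution_for A B z \<longleftrightarrow> lp_basis A B \<and> (\<forall>v. v \<notin> B \<longrightarrow> z $ v = 0)"

definition basic_feasible_solution :: "real^'v^'m \<Rightarrow> real^'m \<Rightarrow> real^'v \<Rightarrow> bool" where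
  "basic_feasible_solution A b z \<longleftrightarrow> std_feasible A b z \<and> (\<exists>B. basic_solution_for A B z)"

definition nondegenerate :: "real^'v^'m \<Rightarrow> real^'v \<Rightarrow> bool" where
  "nondegenerate A z \<longleftrightarrow> (\<forall>B. basic_solution_for A B z \<longrightarrow> (\<forall>v\<in>B. 0 < z $ v))"

definition std_optimal :: "real^'v^'m \<Rightarrow> real^'m \<Rightarrow> real^'v \<Rightarrow> real^'v \<Rightarrow> bool" where
  "std_optimal A b q z \<longleftrightarrow>
     std_feasible A b z \<and> (\<forall>z'. std_feasible A b z' \<longrightarrow> q \<bullet> z \<le> q \<bullet> z')"

subsection \<open>The linear program and its optimal value\<close>

text \<open>The index set \<open>[N]\<close> is the finite type \<open>'n\<close>; \<open>c1\<close> and \<open>c2\<close> are the costs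
  \<open>c\<^sub>(\<^sub>i\<^sub>)\<close> and \<open>c\<^sub>(\<^sub>i\<^sub>,\<^sub>j\<^sub>)\<close>.\<close>

definition lp_feasible ::
  "('n::finite \<Rightarrow> real) \<Rightarrow> real^'n \<Rightarrow> ('n \<Rightarrow> 'n \<Rightarrow> real) \<Rightarrow> ('n \<Rightarrow> real) \<Rightarrow> bool" where
  "lp_feasible \<theta> l x y \<longleftrightarrow>
     (\<forall>i. (\<Sum>j\<in>UNIV. x j i) + (\<Sum>j\<in>UNIV. x i j) + y i = l $ i) \<and>
     (\<forall>i j. \<theta> i * x i j \<le> l $ j * y i) \<and>
     (\<forall>i j. 0 \<le> x i j) \<and> (\<forall>i. 0 \<le> y i)"

definition lp_objective ::
  "('n::finite \<Rightarrow> real) \<Rightarrow> ('n \<Rightarrow> 'n \<Rightarrow> real) \<Rightarrow> ('n \<Rightarrow> 'n \<Rightarrow> real) \<Rightarrow> ('n \<Rightarrow> real) \<Rightarrow> real" where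
  "lp_objective c1 c2 x y = (\<Sum>i\<in>UNIV. \<Sum>j\<in>UNIV. c2 i j * x i j) + (\<Sum>i\<in>UNIV. c1 i * y i)"

text \<open>For positive costs and \<open>l > 0\<close> the feasible set is nonempty (\<open>x = 0\<close>, \<open>y = l\<close>) and the
  objective is bounded below by \<open>0\<close>, so the infimum is the optimal value.\<close>

definition opt_value ::
  "('n::finite \<Rightarrow> real) \<Rightarrow> ('n \<Rightarrow> 'n \<Rightarrow> real) \<Rightarrow> ('n \<Rightarrow> real) \<Rightarrow> real^'n \<Rightarrow> real" where
  "opt_value c1 c2 \<theta> l = Inf {lp_objective c1 c2 x y | x y. lp_feasible \<theta> l x y}"

subsection \<open>Its standard form\<close>

type_synonym 'n lp_var = "('n \<times> 'n) + ('n + ('n \<times> 'n))"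
type_synonym 'n lp_eqn = "'n + ('n \<times> 'n)"

abbreviation x_var :: "'n \<Rightarrow> 'n \<Rightarrow> 'n lp_var" where "x_var i j \<equiv> Inl (i, j)"
abbreviation y_var :: "'n \<Rightarrow> 'n lp_var" where "y_var i \<equiv> Inr (Inl i)"
abbreviation slack_var :: "'n \<Rightarrow> 'n \<Rightarrow> 'n lp_var" where "slack_var i j \<equiv> Inr (Inr (i, j))"

abbreviation balance_eqn :: "'n \<Rightarrow> 'n lp_eqn" where "balance_eqn k \<equiv> Inl k"
abbreviation ratio_eqn :: "'n \<Rightarrow> 'n \<Rightarrow> 'n lp_eqn" where "ratio_eqn i j \<equiv> Inr (i, j)"

text \<open>Note that \<open>x\<^sub>i\<^sub>i\<close> occurs twice in the balance equation of \<open>i\<close>.\<close>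

definition std_matrix :: "('n::finite \<Rightarrow> real) \<Rightarrow> real^'n \<Rightarrow> real^'n lp_var^'n lp_eqn" where
  "std_matrix \<theta> l = (\<chi> r v. case r of
       balance_eqn k \<Rightarrow> (case v of
           x_var i j \<Rightarrow> of_bool (j = k) + of_bool (i = k)
         | y_var i \<Rightarrow> of_bool (i = k)
         | slack_var i j \<Rightarrow> 0)
     | ratio_eqn i' j' \<Rightarrow> (case v of
           x_var i j \<Rightarrow> if i = i' \<and> j = j' then \<theta> i' else 0
         | y_var i \<Rightarrow> if i = i' then - (l $ j') else 0
         | slack_var i j \<Rightarrow> of_bool (i = i' \<and> j = j')))"

definition std_rhs :: "real^'n \<Rightarrow> real^('n::finite) lp_eqn" where
  "std_rhs l = (\<chi> r. case r of balance_eqn k \<Rightarrow> l $ k | ratio_eqn i j \<Rightarrow> 0)"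

definition std_cost :: "('n::finite \<Rightarrow> real) \<Rightarrow> ('n \<Rightarrow> 'n \<Rightarrow> real) \<Rightarrow> real^'n lp_var" where
  "std_cost c1 c2 = (\<chi> v. case v of x_var i j \<Rightarrow> c2 i j | y_var i \<Rightarrow> c1 i | slack_var i j \<Rightarrow> 0)"

lemma sum_UNIV_Plus:
  fixes f :: "'a::finite + 'b::finite \<Rightarrow> real"
  shows "(\<Sum>v\<in>UNIV. f v) = (\<Sum>a\<in>UNIV. f (Inl a)) + (\<Sum>b\<in>UNIV. f (Inr b))"
  unfolding UNIV_Plus_UNIV[symmetric] by (subst sum.Plus) auto

lemma sum_UNIV_Times:
  fixes f :: "'a::finite \<times> 'b::finite \<Rightarrow> real"
  shows "(\<Sum>p\<in>UNIV. f p) = (\<Sum>i\<in>UNIV. \<Sum>j\<in>UNIV. f (i, j))"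
  unfolding UNIV_Times_UNIV[symmetric] by (simp add: sum.cartesian_product)

lemma std_feasible_iff:
  fixes l :: "real^'n::finite"
  shows "std_feasible (std_matrix \<theta> l) (std_rhs l) z \<longleftrightarrow>
     (\<forall>i. (\<Sum>j\<in>UNIV. z $ x_var j i) + (\<Sum>j\<in>UNIV. z $ x_var i j) + z $ y_var i = l $ i) \<and>
     (\<forall>i j. \<theta> i * z $ x_var i j + z $ slack_var i j = l $ j * z $ y_var i) \<and>
     (\<forall>v. 0 \<le> z $ v)"
proof -
  have pull: "(\<Sum>j\<in>UNIV. if P then g j else 0) = (if P then \<Sum>j\<in>UNIV. g j else 0)"
    for P and g :: "'n \<Rightarrow> real" by simp
  have bal: "(std_matrix \<theta> l *v z) $ balance_eqn k =
      (\<Sum>j\<in>UNIV. z $ x_var j k) + (\<Sum>j\<in>UNIV. z $ x_var k j) + z $ y_var k" for k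
    by (simp add: matrix_vector_mult_def std_matrix_def sum_UNIV_Plus sum_UNIV_Times
        distrib_right sum.distrib of_bool_def if_distrib[of "\<lambda>t. t * _"]
        pull cong: if_cong)
  have ite: "(if i = a \<and> j = b then t else 0) = (if i = a then (if j = b then t else 0) else 0)"
    for i a j b :: 'n and t :: real by simp
  have rat: "(std_matrix \<theta> l *v z) $ ratio_eqn i j =
      \<theta> i * z $ x_var i j - l $ j * z $ y_var i + z $ slack_var i j" for i j
    by (simp add: matrix_vector_mult_def std_matrix_def sum_UNIV_Plus sum_UNIV_Times
        of_bool_def if_distrib[of "\<lambda>t. t * _"] ite pull cong: if_cong)
  show ?thesis
    unfolding std_feasible_def vec_eq_iff split_sum_all split_paired_All bal rat
    by (auto simp: std_rhs_def algebra_simps)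
qed

lemma inner_std_cost:
  "std_cost c1 c2 \<bullet> z = lp_objective c1 c2 (\<lambda>i j. z $ x_var i j) (\<lambda>i. z $ y_var i)"
  by (simp add: inner_vec_def std_cost_def lp_objective_def sum_UNIV_Plus sum_UNIV_Times)

subsection \<open>Weak concavity\<close>

definition weakly_concave_on :: "'a::real_normed_vector set \<Rightarrow> ('a \<Rightarrow> real) \<Rightarrow> bool" where
  "weakly_concave_on S f \<longleftrightarrow> (\<exists>\<rho>\<ge>0. concave_on S (\<lambda>l. f l - \<rho> * (norm l)\<^sup>2 / 2))"

end

theory Submission
  imports Defs
begin

text \<open>Fix \<open>l\<close> in the box and an optimal basis \<open>B\<close> at \<open>l\<close>. As long as the basic solution of \<open>B\<close> stays
  nonnegative, its cost bounds the optimal value at \<open>l + d\<close> from above, and it equals the optimal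
  value at \<open>l\<close> plus a linear term in \<open>d\<close> plus \<open>O(\<bar>d\<bar>\<^sup>2)\<close>. Nondegeneracy makes this uniform in \<open>l\<close>: the
  optimal pairs \<open>(l, z)\<close> with \<open>z\<close> supported in \<open>B\<close> form a compact set, on which \<open>B\<close> is always a basis
  (a basic optimal solution supported in \<open>supp z\<close> has full support \<open>B\<close>) and \<open>z > 0\<close> on \<open>B\<close>. Thus the
  optimal value has a quadratic upper support with a common constant at every point, which is
  weak concavity.\<close>

subsection \<open>Bases and basic optimal solutions\<close>

text \<open>\<open>A *v w\<close> is the combination of the columns with coefficients
  \<open>w\<close>, so the condition on \<open>S\<close> says that the kernel is trivial on vectors
  supported there. This form treats repeated columns and dependence alike: two equal columns already
  give a kernel vector.\<close>

lemma independent_columns_iff: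
  fixes A :: "real^'v^'m"
  shows "inj_on (\<lambda>v. column v A) S \<and> independent ((\<lambda>v. column v A) ` S) \<longleftrightarrow>
    (\<forall>w. (\<forall>v. v \<notin> S \<longrightarrow> w $ v = 0) \<longrightarrow> A *v w = 0 \<longrightarrow> w = 0)" (is "?L \<longleftrightarrow> ?R")
proof
  assume L: ?L
  show ?R
  proof (intro allI impI)
    fix w assume w: "\<forall>v. v \<notin> S \<longrightarrow> w $ v = 0" and Aw: "A *v w = 0"
    let ?col = "\<lambda>v. column v A"
    let ?u = "\<lambda>c. w $ inv_into S ?col c"
    have inv: "inv_into S ?col (?col v) = v" if "v \<in> S" for v
      using L that inv_into_f_f[of ?col S v] by simp
    have "(\<Sum>c\<in>?col ` S. ?u c *\<^sub>R c) = (\<Sum>v\<in>S. w $ v *\<^sub>R ?col v)"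
      using L by (simp add: sum.reindex inv)
    also have "\<dots> = (\<Sum>v\<in>UNIV. w $ v *s ?col v)"
      using w by (intro sum.mono_neutral_cong_left) (auto simp: scalar_mult_eq_scaleR)
    also have "\<dots> = 0" using Aw by (simp add: matrix_mult_sum)
    finally have "\<forall>c\<in>?col ` S. ?u c = 0"
      using L dependent_finite[of "?col ` S"] by auto
    then have "\<forall>v\<in>S. w $ v = 0" by (simp add: inv)
    then show "w = 0" using w by (metis vec_eq_iff zero_index)
  qed
next
  assume R: ?R
  let ?col = "\<lambda>v. column v A"
  have inj: "inj_on ?col S"
  proof (rule inj_onI, rule ccontr)
    fix v v' assume v: "v \<in> S" "v' \<in> S" "?col v = ?col v'" "v \<noteq> v'"
    let ?w = "axis v 1 - axis v' 1 :: real^'v"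
    have "A *v ?w = 0"
      using v by (simp add: matrix_vector_mult_diff_distrib matrix_vector_mult_basis)
    moreover have "\<forall>u. u \<notin> S \<longrightarrow> ?w $ u = 0" using v(1,2) by (auto simp: axis_def)
    ultimately have "?w = 0" using R by blast
    then show False using v(4) by (auto simp: axis_eq_axis)
  qed
  moreover have "independent (?col ` S)"
  proof
    assume "dependent (?col ` S)"
    then obtain u where u: "\<exists>c\<in>?col ` S. u c \<noteq> 0" "(\<Sum>c\<in>?col ` S. u c *\<^sub>R c) = 0"
      using dependent_finite[of "?col ` S"] by auto
    define w :: "real^'v" where "w = (\<chi> v. if v \<in> S then u (?col v) else 0)"
    have "A *v w = (\<Sum>v\<in>S. u (?col v) *\<^sub>R ?col v)"
      unfolding matrix_mult_sum
      by (intro sum.mono_neutral_cong_right) (auto simp: w_def scalar_mult_eq_scaleR)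
    also have "\<dots> = 0" using u(2) inj by (simp add: sum.reindex)
    finally have "w = 0" using R by (simp add: w_def)
    then show False using u(1) by (auto simp: w_def vec_eq_iff split: if_splits)
  qed
  ultimately show ?L by blast
qed

text \<open>Surjectivity makes the columns span the whole space, so a maximal independent set of
  columns containing those of \<open>S\<close> has \<open>CARD('m)\<close> elements. It remains to
  pick one index for each of its columns.\<close>

lemma extend_to_lp_basis:
  fixes A :: "real^'v^'m"
  assumes inj: "inj_on (\<lambda>v. column v A) S" and indep: "independent ((\<lambda>v. column v A) ` S)"
    and surj: "surj ((*v) A)"
  obtains B where "S \<subseteq> B" "lp_basis A B"
proof -
  let ?col = "\<lambda>v. column v A"
  obtain T where T: "?col ` S \<subseteq> T" "T \<subseteq> range ?col" "independent T" "range ?col \<subseteq> span T"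
    using maximal_independent_subset_extend[of "?col ` S" "range ?col"] indep by blast
  have "y \<in> span T" for y
  proof -
    obtain x where "y = A *v x" using surj by (metis surjD)
    then show ?thesis
      using T(4) by (auto simp: matrix_mult_sum scalar_mult_eq_scaleR intro!: span_sum span_scale)
  qed
  then have "span T = UNIV" by blast
  then have cT: "card T = CARD('m)"
    using T(3) by (metis dim_eq_card_independent dim_UNIV dim_span DIM_cart DIM_real mult.right_neutral)
  \<comment> \<open>A column indexed by \<open>S\<close> may also occur at an index outside
    \<open>S\<close>; the index in \<open>S\<close> has to be chosen so that \<open>S\<close> ends
    up inside \<open>B\<close>.\<close>
  define g where "g c = (if c \<in> ?col ` S then inv_into S ?col c else inv ?col c)" for c
  have col_g: "?col (g c) = c" if "c \<in> T" for c
    using that T(2) unfolding g_def by (auto intro: f_inv_into_f simp: f_inv_into_f[of _ ?col])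
  define B where "B = g ` T"
  have "inj_on ?col B"
    unfolding B_def by (rule inj_onI) (auto simp: col_g)
  moreover have "?col ` B = T"
    unfolding B_def image_image using col_g by simp
  moreover have "S \<subseteq> B"
  proof
    fix v assume "v \<in> S"
    then have "g (?col v) = v" "?col v \<in> T"
      using inj T(1) inv_into_f_f[of ?col S v] by (auto simp: g_def)
    then show "v \<in> B" unfolding B_def by (metis imageI)
  qed
  ultimately show thesis
    using that[of B] cT T(3) unfolding lp_basis_def by (metis card_image)
qed

text \<open>An optimal solution of minimal support has independent columns: a kernel vector supported
  there does not change the cost, so one could move along it until a coordinate vanishes.\<close>

lemma optimal_basic_solution_exists:
  fixes A :: "real^'v^'m"
  assumes opt: "std_optimal A b q z" and surj: "surj ((*v) A)"
  obtains z' B where "std_optimal A b q z'" "basic_solution_for A B z'"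
    "\<And>v. z $ v = 0 \<Longrightarrow> z' $ v = 0"
proof -
  let ?supp = "\<lambda>x::real^'v. {v. x $ v \<noteq> 0}"
  let ?P = "\<lambda>x. std_optimal A b q x \<and> ?supp x \<subseteq> ?supp z"
  define x where "x = arg_min (\<lambda>x. card (?supp x)) ?P"
  have Px: "?P x" and min: "\<And>y. ?P y \<Longrightarrow> card (?supp x) \<le> card (?supp y)"
    using arg_min_nat_lemma[of ?P z "\<lambda>x. card (?supp x)"] opt unfolding x_def by auto
  have feas: "A *v x = b" "\<And>v. 0 \<le> x $ v"
    and xmin: "\<And>y. std_feasible A b y \<Longrightarrow> q \<bullet> x \<le> q \<bullet> y"
    using Px by (auto simp: std_optimal_def std_feasible_def)
  \<comment> \<open>Ratio test: \<open>t\<close> below is the longest step along \<open>w\<close>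
    that keeps \<open>x\<close> nonnegative. It empties the coordinate \<open>u'\<close> and brings
    no new coordinate into the support, so an optimal solution of smaller support would
    arise.\<close>
  have no_neg: False
    if w: "\<forall>v. x $ v = 0 \<longrightarrow> w $ v = 0" "A *v w = 0" "w $ u < 0" "q \<bullet> w \<le> 0" for w u
  proof -
    let ?N = "{v. w $ v < 0}"
    define t where "t = Min ((\<lambda>v. x $ v / - w $ v) ` ?N)"
    have fin: "finite ((\<lambda>v. x $ v / - w $ v) ` ?N)" "(\<lambda>v. x $ v / - w $ v) ` ?N \<noteq> {}"
      using w(3) by auto
    obtain u' where u': "w $ u' < 0" "t = x $ u' / - w $ u'"
      using Min_in[OF fin] by (auto simp: t_def)
    have tle: "t \<le> x $ v / - w $ v" if "w $ v < 0" for v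
      using Min_le[OF fin(1)] that by (auto simp: t_def)
    have t0: "0 \<le> t" unfolding u'(2) using u'(1) feas(2)[of u'] by (intro divide_nonneg_pos) auto
    let ?y = "x + t *\<^sub>R w"
    have "0 \<le> ?y $ v" for v
    proof (cases "w $ v < 0")
      case True
      then show ?thesis using tle[of v] by (simp add: field_simps)
    next
      case False
      then show ?thesis using t0 feas(2)[of v] by simp
    qed
    then have yf: "std_feasible A b ?y"
      using feas(1) w(2) by (simp add: std_feasible_def matrix_vector_right_distrib
          matrix_vector_mult_scaleR)
    moreover have "q \<bullet> ?y \<le> q \<bullet> x"
      using w(4) t0 by (simp add: inner_add_right mult_nonneg_nonpos)
    ultimately have "std_optimal A b q ?y"
      using xmin by (force simp: std_optimal_def)
    moreover have sub: "?supp ?y \<subset> ?supp x"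
    proof
      show "?supp ?y \<subseteq> ?supp x" using w(1) by auto
      have "u' \<in> ?supp x" "u' \<notin> ?supp ?y" using w(1) u' by auto
      then show "?supp ?y \<noteq> ?supp x" by blast
    qed
    ultimately have "card (?supp x) \<le> card (?supp ?y)" using min Px by blast
    moreover have "card (?supp ?y) < card (?supp x)" using sub by (intro psubset_card_mono) auto
    ultimately show False by simp
  qed
  have ker0: "w = 0"
    if w: "\<forall>v. x $ v = 0 \<longrightarrow> w $ v = 0" "A *v w = 0" and cost: "q \<bullet> w \<le> 0" for w
  proof (rule ccontr)
    assume "w \<noteq> 0"
    then obtain u where u: "w $ u \<noteq> 0" by (metis vec_eq_iff zero_index)
    \<comment> \<open>Negative coordinates are excluded by \<open>no_neg\<close>. Hence
      \<open>x + w\<close> is feasible, so \<open>w\<close> has cost zero, and \<open>- w\<close>,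
      which is negative at \<open>u\<close>, falls under \<open>no_neg\<close> as well.\<close>
    have nonneg: "0 \<le> w $ v" for v using no_neg[of w v] w cost by force
    have "std_feasible A b (x + w)"
      using feas w nonneg by (simp add: std_feasible_def matrix_vector_right_distrib)
    then have "q \<bullet> x \<le> q \<bullet> (x + w)" by (rule xmin)
    then have "q \<bullet> w = 0" using cost by (simp add: inner_add_right)
    moreover have "A *v (- w) = 0"
      using w(2) matrix_vector_mult_diff_distrib[of A 0 w] by simp
    ultimately show False
      using no_neg[of "- w" u] w u nonneg[of u] by simp
  qed
  \<comment> \<open>At least one of \<open>w\<close> and \<open>- w\<close> does not raise the
    cost.\<close>
  have "w = 0" if w: "\<forall>v. v \<notin> ?supp x \<longrightarrow> w $ v = 0" "A *v w = 0" for w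
  proof (cases "q \<bullet> w \<le> 0")
    case True
    then show ?thesis using ker0 w by simp
  next
    case False
    moreover have "A *v (- w) = 0"
      using w(2) matrix_vector_mult_diff_distrib[of A 0 w] by simp
    ultimately have "- w = 0" using w(1) by (intro ker0) auto
    then show ?thesis by simp
  qed
  then have "inj_on (\<lambda>v. column v A) (?supp x)" "independent ((\<lambda>v. column v A) ` ?supp x)"
    using independent_columns_iff[of A "?supp x"] by auto
  then obtain B where "?supp x \<subseteq> B" "lp_basis A B"
    using extend_to_lp_basis surj by blast
  then show thesis
    using that[of x B] Px by (auto simp: basic_solution_for_def)
qed

subsection \<open>Perturbation of a basic solution\<close>

lemma linear_image_eq_UNIV:
  fixes f :: "'a::euclidean_space \<Rightarrow> 'b::euclidean_space"
  assumes "linear f" "subspace V" "dim V = DIM('b)" "inj_on f V"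
  shows "f ` V = UNIV"
proof -
  have "dim (f ` V) = DIM('b)"
    using assms dim_image_eq[OF assms(1), of V] by (metis span_eq_iff)
  then have "span (f ` V) = UNIV" using dim_eq_full by blast
  then show ?thesis
    using linear_subspace_image[OF assms(1,2)] by (metis span_eq_iff)
qed

lemma subspace_supported: "subspace {w::real^'v. \<forall>v. v \<notin> B \<longrightarrow> w $ v = 0}"
  by (auto simp: subspace_def)

text \<open>Here \<open>D d\<close> is the change of the matrix and \<open>\<beta> d\<close> that of
  the right-hand side. A correction \<open>w\<close> supported in \<open>B\<close> has to satisfy
  \<open>A *v w = \<beta> d - D d z - D d w\<close>. Since \<open>A\<close> is invertible on such
  vectors with inverse of norm at most \<open>1 / e\<close>, \<open>w\<close> is of order
  \<open>norm d\<close>; dropping \<open>D d w\<close> leaves the linear term \<open>g d\<close> and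
  costs an error of second order. All bounds are explicit in \<open>C\<close>, \<open>R\<close> and
  \<open>e\<close>, so that they do not depend on the point of expansion.\<close>

lemma perturbed_basic_solution:
  fixes A :: "real^'v^'m" and D :: "'a::real_normed_vector \<Rightarrow> real^'v \<Rightarrow> real^'m"
    and \<beta> :: "'a \<Rightarrow> real^'m"
  assumes D: "bounded_bilinear D" and \<beta>: "bounded_linear \<beta>"
    and C: "0 < C" "\<And>d z. norm (D d z) \<le> C * norm d * norm z" "\<And>d. norm (\<beta> d) \<le> C * norm d"
    and cardB: "card B = CARD('m)"
    and e: "0 < e" "\<And>w. \<forall>v. v \<notin> B \<longrightarrow> w $ v = 0 \<Longrightarrow> e * norm w \<le> norm (A *v w)"
    and z: "A *v z = b" "\<And>v. v \<notin> B \<Longrightarrow> z $ v = 0" "\<And>v. v \<in> B \<Longrightarrow> e \<le> z $ v" "norm z \<le> R"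
  obtains g :: "'a \<Rightarrow> real" where "linear g"
    "\<And>d. norm (g d) \<le> norm q * (C * (1 + R) / e) * norm d"
    "\<And>d. norm d \<le> min (e / (2 * C)) (e\<^sup>2 / (2 * C * (1 + R))) \<Longrightarrow>
      \<exists>z'. A *v z' + D d z' = b + \<beta> d \<and> (\<forall>v. 0 \<le> z' $ v) \<and>
        q \<bullet> z' \<le> q \<bullet> z + g d + norm q * (2 * C\<^sup>2 * (1 + R) / e\<^sup>2) * (norm d)\<^sup>2"
proof -
  interpret D: bounded_bilinear D by (rule D)
  interpret \<beta>: bounded_linear \<beta> by (rule \<beta>)
  define V where "V = {w::real^'v. \<forall>v. v \<notin> B \<longrightarrow> w $ v = 0}"
  have V: "subspace V" unfolding V_def by (rule subspace_supported)
  have dimV: "dim V = DIM(real^'m)"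
    using dim_substandard_cart[of B, where 'a = real] cardB by (simp add: V_def dim_vec_eq)
  \<comment> \<open>Stated for a general \<open>f\<close> because it serves both for
    \<open>A\<close> and for the perturbed matrix \<open>A + D d\<close>.\<close>
  have onto: "f ` V = UNIV"
    if "linear f" "\<And>w. w \<in> V \<Longrightarrow> e' * norm w \<le> norm (f w)" "0 < e'" for f :: "_ \<Rightarrow> real^'m" and e'
  proof (rule linear_image_eq_UNIV[OF that(1) V dimV])
    show "inj_on f V"
    proof (rule inj_onI)
      fix x y assume xy: "x \<in> V" "y \<in> V" "f x = f y"
      have "e' * norm (x - y) \<le> norm (f (x - y))"
        using V xy by (intro that(2)) (auto intro: subspace_diff)
      also have "f (x - y) = 0" using xy(3) that(1) by (simp add: linear_diff)
      finally show "x = y" using that(3) by (simp add: mult_le_0_iff)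
    qed
  qed
  have linA: "linear ((*v) A)" by simp
  have lowA: "e * norm w \<le> norm (A *v w)" if "w \<in> V" for w
    using that e(2) by (simp add: V_def)
  have surjA: "(*v) A ` V = UNIV" by (rule onto[OF linA lowA e(1)])
  have injA: "inj_on ((*v) A) V"
  proof (rule inj_onI)
    fix x y assume xy: "x \<in> V" "y \<in> V" "A *v x = A *v y"
    have "e * norm (x - y) \<le> norm (A *v (x - y))"
      using V xy by (intro lowA) (auto intro: subspace_diff)
    then show "x = y" using xy(3) e(1) by (simp add: matrix_vector_mult_diff_distrib mult_le_0_iff)
  qed
  obtain M where M: "linear M" "\<And>w. w \<in> V \<Longrightarrow> M (A *v w) = w"
    using linear_exists_left_inverse_on[OF linA V injA] by blast
  have normM: "norm (M u) \<le> norm u / e" for u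
  proof -
    obtain w where "w \<in> V" "u = A *v w" using surjA by blast
    then show ?thesis using lowA[of w] M(2)[of w] e(1) by (simp add: field_simps)
  qed
  have R: "0 \<le> R" using z(4) norm_ge_zero order_trans by blast
  \<comment> \<open>The change of cost along the first-order correction, which solves the equation
    without the term \<open>D d w\<close>.\<close>
  define g where "g d = q \<bullet> M (\<beta> d - D d z)" for d
  have residual: "norm (\<beta> d - D d z) \<le> C * (1 + R) * norm d" for d
  proof -
    have "norm (\<beta> d - D d z) \<le> norm (\<beta> d) + norm (D d z)" by (rule norm_triangle_ineq4)
    also have "\<dots> \<le> C * norm d + C * norm d * R"
      using C z(4) by (intro add_mono order_trans[OF C(2)] mult_left_mono) auto
    finally show ?thesis by (simp add: algebra_simps)
  qed
  have "linear g"
    unfolding g_def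
    by (rule linearI)
      (simp_all add: \<beta>.add \<beta>.scaleR D.add_left D.scaleR_left linear_add[OF M(1)] linear_diff[OF M(1)]
        linear_cmul[OF M(1)] inner_add_right inner_diff_right algebra_simps)
  moreover have "norm (g d) \<le> norm q * (C * (1 + R) / e) * norm d" for d
  proof -
    have "norm (g d) \<le> norm q * norm (M (\<beta> d - D d z))"
      unfolding g_def real_norm_def by (rule Cauchy_Schwarz_ineq2)
    also have "\<dots> \<le> norm q * (C * (1 + R) * norm d / e)"
      using normM[of "\<beta> d - D d z"] residual[of d] e(1)
      by (intro mult_left_mono order_trans[OF normM] divide_right_mono) auto
    finally show ?thesis by simp
  qed
  moreover have "\<exists>z'. A *v z' + D d z' = b + \<beta> d \<and> (\<forall>v. 0 \<le> z' $ v) \<and>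
        q \<bullet> z' \<le> q \<bullet> z + g d + norm q * (2 * C\<^sup>2 * (1 + R) / e\<^sup>2) * (norm d)\<^sup>2"
    if d: "norm d \<le> min (e / (2 * C)) (e\<^sup>2 / (2 * C * (1 + R)))" for d
  proof -
    let ?f = "\<lambda>w. A *v w + D d w"
    \<comment> \<open>The first bound on \<open>norm d\<close> lets \<open>D d\<close> use up at
      most half of the lower bound \<open>e\<close> of \<open>A\<close> on \<open>V\<close>.\<close>
    have d1: "C * norm d \<le> e / 2" using d C(1) by (simp add: field_simps)
    \<comment> \<open>The second bound on \<open>norm d\<close> will give
      \<open>norm w \<le> e\<close>, so \<open>z + w\<close> stays nonnegative on \<open>B\<close>,
      where \<open>z\<close> is at least \<open>e\<close>.\<close>
    have "0 < 2 * C * (1 + R)" using C(1) R by simp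
    then have d2: "2 * C * (1 + R) * norm d \<le> e\<^sup>2"
      using d by (simp add: pos_le_divide_eq mult.commute)
    have linf: "linear ?f"
      by (intro linear_compose_add linA bounded_linear.linear[OF D.bounded_linear_right])
    have lowf: "e / 2 * norm w \<le> norm (?f w)" if "w \<in> V" for w
    proof -
      have "norm (D d w) \<le> e / 2 * norm w"
        using C(2)[of d w] d1 by (meson mult_right_mono norm_ge_zero order_trans)
      moreover have "norm (A *v w) - norm (D d w) \<le> norm (?f w)" by (rule norm_diff_ineq)
      ultimately show ?thesis using lowA[OF that] by (simp add: field_simps)
    qed
    have "?f ` V = UNIV" by (rule onto[OF linf lowf]) (use e in auto)
    then have "\<beta> d - D d z \<in> ?f ` V" by simp
    then obtain w where w: "w \<in> V" "?f w = \<beta> d - D d z" by force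
    have wn: "norm w \<le> 2 / e * (C * (1 + R) * norm d)"
    proof -
      have "e / 2 * norm w \<le> C * (1 + R) * norm d"
        using lowf[OF w(1)] residual[of d] unfolding w(2) by (rule order_trans)
      then show ?thesis using e(1) by (simp add: field_simps)
    qed
    also have "\<dots> \<le> e" using d2 e(1) by (simp add: field_simps power2_eq_square)
    finally have we: "norm w \<le> e" .
    have "A *v (z + w) + D d (z + w) = b + \<beta> d"
      using w(2) z(1) by (simp add: matrix_vector_right_distrib D.add_right algebra_simps)
    moreover have "0 \<le> (z + w) $ v" for v
    proof (cases "v \<in> B")
      case True
      then show ?thesis using z(3)[of v] we component_le_norm_cart[of w v] by simp
    next
      case False
      then show ?thesis using z(2)[of v] w(1) by (simp add: V_def)
    qed
    moreover have "q \<bullet> (z + w) \<le> q \<bullet> z + g d + norm q * (2 * C\<^sup>2 * (1 + R) / e\<^sup>2) * (norm d)\<^sup>2"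
    proof -
      \<comment> \<open>Applying \<open>M\<close> to the exact equation isolates the error
        \<open>M (D d w)\<close>, a product of two factors of order \<open>norm d\<close>.\<close>
      have "w = M (\<beta> d - D d z - D d w)"
        using M(2)[OF w(1)] w(2) by (metis add_diff_cancel_right')
      also have "\<dots> = M (\<beta> d - D d z) - M (D d w)" by (rule linear_diff[OF M(1)])
      finally have "q \<bullet> w = g d - q \<bullet> M (D d w)" by (metis g_def inner_diff_right)
      moreover have "- (q \<bullet> M (D d w)) \<le> norm q * (2 * C\<^sup>2 * (1 + R) / e\<^sup>2) * (norm d)\<^sup>2"
      proof -
        have "- (q \<bullet> M (D d w)) \<le> norm q * norm (M (D d w))"
          using Cauchy_Schwarz_ineq2[of q "M (D d w)"] by linarith
        also have "\<dots> \<le> norm q * (C * norm d * norm w / e)"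
          using C(2) e(1) by (intro mult_left_mono order_trans[OF normM] divide_right_mono) auto
        also have "\<dots> \<le> norm q * (C * norm d * (2 / e * (C * (1 + R) * norm d)) / e)"
          using wn C(1) e(1) by (intro mult_left_mono divide_right_mono) auto
        finally show ?thesis by (simp add: power2_eq_square mult_ac)
      qed
      ultimately show ?thesis by (simp add: inner_add_right)
    qed
    ultimately show ?thesis by blast
  qed
  ultimately show thesis using that by blast
qed

subsection \<open>Weak concavity of parametric linear programs\<close>

text \<open>Subtracting \<open>K\<close> times the squared norm turns the quadratic support at each
  point into an affine one, and a function with an affine upper support at every point of a convex
  set is concave. The modulus is therefore \<open>2 * K\<close>.\<close>

lemma weakly_concave_on_if_quadratic_upper_support:
  fixes f :: "'a::real_inner \<Rightarrow> real"
  assumes S: "convex S" and K: "0 \<le> K"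
    and sup: "\<And>x. x \<in> S \<Longrightarrow>
      \<exists>g. linear g \<and> (\<forall>y\<in>S. f y \<le> f x + g (y - x) + K * (norm (y - x))\<^sup>2)"
  shows "weakly_concave_on S f"
proof -
  let ?h = "\<lambda>l. f l - 2 * K * (norm l)\<^sup>2 / 2"
  have "concave_on S ?h"
    unfolding concave_on_iff
  proof (intro conjI S ballI allI impI)
    fix x y and u v :: real
    assume xy: "x \<in> S" "y \<in> S" and uv: "0 \<le> u" "0 \<le> v" "u + v = 1"
    define p where "p = u *\<^sub>R x + v *\<^sub>R y"
    have "p \<in> S" unfolding p_def using S xy uv by (rule convexD)
    then obtain g where g: "linear g"
      "\<And>y. y \<in> S \<Longrightarrow> f y \<le> f p + g (y - p) + K * (norm (y - p))\<^sup>2"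
      using sup by blast
    \<comment> \<open>\<open>G\<close> absorbs the cross term of the squared distance to
      \<open>p\<close>; the two squared norms go into \<open>?h\<close>.\<close>
    define G where "G d = g d - 2 * K * (p \<bullet> d)" for d
    have hle: "?h a \<le> ?h p + G (a - p)" if "a \<in> S" for a
      using g(2)[OF that] unfolding G_def
      by (simp add: power2_norm_eq_inner inner_diff_left inner_diff_right inner_commute algebra_simps)
    have "u *\<^sub>R (x - p) + v *\<^sub>R (y - p) = (u *\<^sub>R x + v *\<^sub>R y) - (u + v) *\<^sub>R p"
      by (simp add: algebra_simps)
    also have "\<dots> = 0" using uv(3) by (simp add: p_def)
    finally have zero: "u *\<^sub>R (x - p) + v *\<^sub>R (y - p) = 0" .
    have "linear G"
      unfolding G_def
      by (rule linearI) (simp_all add: linear_add[OF g(1)] linear_cmul[OF g(1)] inner_add_right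
          algebra_simps)
    then have "u * G (x - p) + v * G (y - p) = G (u *\<^sub>R (x - p) + v *\<^sub>R (y - p))"
      by (simp only: linear_add linear_cmul real_scaleR_def)
    also have "\<dots> = 0" unfolding zero using \<open>linear G\<close> by (rule linear_0)
    finally have G0: "u * G (x - p) + v * G (y - p) = 0" .
    have "u * ?h x + v * ?h y \<le> u * (?h p + G (x - p)) + v * (?h p + G (y - p))"
      using hle xy uv by (intro add_mono mult_left_mono) auto
    also have "\<dots> = (u + v) * ?h p + (u * G (x - p) + v * G (y - p))" by (simp add: algebra_simps)
    also have "\<dots> = ?h p" using G0 uv(3) by simp
    finally show "u * ?h x + v * ?h y \<le> ?h (u *\<^sub>R x + v *\<^sub>R y)" by (simp add: p_def)
  qed
  then show ?thesis
    unfolding weakly_concave_on_def using K by (intro exI[of _ "2 * K"]) auto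
qed

text \<open>Inside the support of \<open>z\<close> lies a basic optimal \<open>z'\<close>, and
  nondegeneracy makes its basis equal to its support. That basis is contained in \<open>B\<close>
  and has the same size, so it is \<open>B\<close>, and trivial kernel on \<open>B\<close> gives
  \<open>z = z'\<close>. Thus the closed condition of being supported in \<open>B\<close> already
  yields the open ones.\<close>

lemma nondegenerate_optimal_on_basis:
  fixes A :: "real^'v^'m"
  assumes opt: "std_optimal A b q z" and surj: "surj ((*v) A)"
    and nondeg: "\<And>z. basic_feasible_solution A b z \<Longrightarrow> std_optimal A b q z \<Longrightarrow> nondegenerate A z"
    and supp: "\<And>v. v \<notin> B \<Longrightarrow> z $ v = 0" and card: "card B = CARD('m)"
  shows "lp_basis A B" "\<And>v. v \<in> B \<Longrightarrow> 0 < z $ v"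
proof -
  obtain z' B' where z': "std_optimal A b q z'" "basic_solution_for A B' z'"
    "\<And>v. z $ v = 0 \<Longrightarrow> z' $ v = 0"
    using optimal_basic_solution_exists[OF opt surj] by blast
  have "nondegenerate A z'"
    using z' by (intro nondeg) (auto simp: basic_feasible_solution_def std_optimal_def)
  then have pos: "0 < z' $ v" if "v \<in> B'" for v
    using z'(2) that by (auto simp: nondegenerate_def)
  have "B' \<subseteq> B" using pos z'(3) supp by force
  moreover have "card B' = CARD('m)" using z'(2) by (simp add: basic_solution_for_def lp_basis_def)
  ultimately have BB: "B' = B" using card by (intro card_subset_eq) auto
  then show basis: "lp_basis A B" using z'(2) by (simp add: basic_solution_for_def)
  have "A *v (z - z') = 0"
    using opt z'(1) by (simp add: std_optimal_def std_feasible_def matrix_vector_mult_diff_distrib)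
  moreover have "\<forall>v. v \<notin> B \<longrightarrow> (z - z') $ v = 0" using supp z'(3) by simp
  ultimately have "z - z' = 0"
    using basis independent_columns_iff[of A B] unfolding lp_basis_def by blast
  then show "\<And>v. v \<in> B \<Longrightarrow> 0 < z $ v" using pos BB by simp
qed

text \<open>Continuous positive functions on compact sets have positive minima: the coordinates in
  \<open>B\<close> on \<open>P\<close>, and \<open>norm (A l *v w)\<close> on the product of
  \<open>P\<close> with the unit vectors supported in \<open>B\<close>, where independence of the
  columns excludes zero. Homogeneity extends the latter to all \<open>w\<close>.\<close>

lemma uniform_basis_bounds:
  fixes A :: "'a::euclidean_space \<Rightarrow> real^'v^'m"
  assumes compact: "compact P"
    and cont: "continuous_on UNIV (\<lambda>(l, z). A l *v z)"
    and basis: "\<And>l z. (l, z) \<in> P \<Longrightarrow> lp_basis (A l) B"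
    and pos: "\<And>l z v. (l, z) \<in> P \<Longrightarrow> v \<in> B \<Longrightarrow> 0 < z $ v"
  shows "\<exists>e>0. \<forall>(l, z)\<in>P. (\<forall>v\<in>B. e \<le> z $ v) \<and>
    (\<forall>w. (\<forall>v. v \<notin> B \<longrightarrow> w $ v = 0) \<longrightarrow> e * norm w \<le> norm (A l *v w))"
proof (cases "P = {}")
  case True
  then show ?thesis by (intro exI[of _ 1]) auto
next
  case False
  have "\<exists>e>0. \<forall>p\<in>P. e \<le> snd p $ v" if "v \<in> B" for v
  proof -
    have "continuous_on P (\<lambda>p. snd p $ v)" by (intro continuous_intros)
    then obtain p where "p \<in> P" "\<forall>p'\<in>P. snd p $ v \<le> snd p' $ v"
      using continuous_attains_inf[OF compact False] by blast
    then show ?thesis using pos[of "fst p" "snd p" v] that by auto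
  qed
  then obtain d where d: "\<And>v. v \<in> B \<Longrightarrow> 0 < d v" "\<And>v p. v \<in> B \<Longrightarrow> p \<in> P \<Longrightarrow> d v \<le> snd p $ v"
    by metis
  define V where "V = {w::real^'v. \<forall>v. v \<notin> B \<longrightarrow> w $ v = 0}"
  define W where "W = V \<inter> sphere 0 1"
  have V: "subspace V" unfolding V_def by (rule subspace_supported)
  have "compact W" unfolding W_def using closed_subspace[OF V] by (intro closed_Int_compact) auto
  then have cPW: "compact (P \<times> W)" using compact by (intro compact_Times)
  have "\<exists>e>0. \<forall>p\<in>P. \<forall>w\<in>W. e \<le> norm (A (fst p) *v w)"
  proof (cases "W = {}")
    case True
    then show ?thesis by (intro exI[of _ 1]) auto
  next
    case W: False
    have "continuous_on (P \<times> W) (\<lambda>x. (fst (fst x), snd x))" by (intro continuous_intros)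
    then have "continuous_on (P \<times> W) (\<lambda>x. norm (A (fst (fst x)) *v snd x))"
      using continuous_on_compose2[OF cont, of "P \<times> W" "\<lambda>x. (fst (fst x), snd x)"]
      by (intro continuous_on_norm) simp
    then obtain x where x: "x \<in> P \<times> W"
      "\<And>y. y \<in> P \<times> W \<Longrightarrow> norm (A (fst (fst x)) *v snd x) \<le> norm (A (fst (fst y)) *v snd y)"
      using continuous_attains_inf[OF cPW] False W by blast
    obtain l z w where xe: "x = ((l, z), w)" by (metis prod.exhaust)
    have "A l *v w \<noteq> 0"
    proof
      assume "A l *v w = 0"
      moreover have "lp_basis (A l) B" using x(1) xe basis by auto
      moreover have "\<forall>v. v \<notin> B \<longrightarrow> w $ v = 0" using x(1) xe by (auto simp: W_def V_def)
      ultimately have "w = 0"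
        using independent_columns_iff[of "A l" B] unfolding lp_basis_def by blast
      then show False using x(1) xe by (auto simp: W_def)
    qed
    moreover have "norm (A l *v w) \<le> norm (A (fst p) *v w')" if "p \<in> P" "w' \<in> W" for p w'
      using x(2)[of "(p, w')"] that xe by simp
    ultimately show ?thesis by (intro exI[of _ "norm (A l *v w)"]) simp
  qed
  then obtain e where e: "0 < e" "\<And>p w. p \<in> P \<Longrightarrow> w \<in> W \<Longrightarrow> e \<le> norm (A (fst p) *v w)" by blast
  have low: "e * norm w \<le> norm (A l *v w)" if "(l, z) \<in> P" "w \<in> V" for l z w
  proof (cases "w = 0")
    case False
    let ?u = "(1 / norm w) *\<^sub>R w"
    have "?u \<in> W" using that(2) False V by (auto simp: W_def subspace_scale)
    then have "e \<le> norm (A l *v ?u)" using e(2)[OF that(1)] by simp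
    also have "\<dots> = norm (A l *v w) / norm w" by (simp add: matrix_vector_mult_scaleR)
    finally show ?thesis using False by (simp add: field_simps)
  qed simp
  define m where "m = Min (insert e (d ` B))"
  have m: "0 < m" "m \<le> e" "\<And>v. v \<in> B \<Longrightarrow> m \<le> d v"
    unfolding m_def using e(1) d(1) by (auto simp: finite_subset[of B UNIV])
  show ?thesis
  proof (intro exI[of _ m] conjI m(1), clarify, intro conjI ballI allI impI)
    fix l z assume lz: "(l, z) \<in> P"
    show "m \<le> z $ v" if "v \<in> B" for v using d(2)[OF that lz] m(3)[OF that] by simp
    show "m * norm w \<le> norm (A l *v w)" if "\<forall>v. v \<notin> B \<longrightarrow> w $ v = 0" for w
    proof -
      have "m * norm w \<le> e * norm w" using m(2) by (rule mult_right_mono) simp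
      also have "\<dots> \<le> norm (A l *v w)" using that by (intro low[OF lz]) (simp add: V_def)
      finally show ?thesis .
    qed
  qed
qed

text \<open>The quadratic support comes from perturbing an optimal basis within a common radius
  \<open>r\<close>; beyond it, boundedness of \<open>f\<close> on \<Lambda> suffices once the
  constant is enlarged.\<close>

lemma parametric_lp_weakly_concave:
  fixes A :: "'a::euclidean_space \<Rightarrow> real^'v^'m" and b :: "'a \<Rightarrow> real^'m" and q :: "real^'v"
  assumes \<Lambda>: "convex \<Lambda>"
    and graph: "compact {(l, z). l \<in> \<Lambda> \<and> std_optimal (A l) (b l) q z}" (is "compact ?G")
    and ex: "\<And>l. l \<in> \<Lambda> \<Longrightarrow> \<exists>z. std_optimal (A l) (b l) q z"
    and surj: "\<And>l. l \<in> \<Lambda> \<Longrightarrow> surj ((*v) (A l))"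
    and A: "\<And>l l' z. A l' *v z = A l *v z + D (l' - l) z" and D: "bounded_bilinear D"
    and b: "\<And>l l'. b l' = b l + \<beta> (l' - l)" and \<beta>: "bounded_linear \<beta>"
    and nondeg: "\<And>l z. l \<in> \<Lambda> \<Longrightarrow> basic_feasible_solution (A l) (b l) z \<Longrightarrow>
      std_optimal (A l) (b l) q z \<Longrightarrow> nondegenerate (A l) z"
    and f: "\<And>l z. l \<in> \<Lambda> \<Longrightarrow> std_optimal (A l) (b l) q z \<Longrightarrow> f l = q \<bullet> z"
  shows "weakly_concave_on \<Lambda> f"
proof -
  have cont: "continuous_on UNIV (\<lambda>(l, z). A l *v z)"
  proof -
    have "(\<lambda>(l, z). A l *v z) = (\<lambda>p. A 0 *v snd p + D (fst p) (snd p))"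
    proof (rule ext, clarify)
      show "A l *v z = A 0 *v snd (l, z) + D (fst (l, z)) (snd (l, z))" for l z
        using A[of l z 0] by simp
    qed
    moreover have "continuous_on UNIV (\<lambda>p. A 0 *v snd p + D (fst p) (snd p))"
      by (intro continuous_intros bounded_bilinear.continuous_on[OF D]
          linear_continuous_on_compose[of _ snd]) auto
    ultimately show ?thesis by simp
  qed
  \<comment> \<open>Only the support is prescribed, not that \<open>B\<close> is a basis at
    \<open>l\<close>: this keeps the set closed in the compact graph.\<close>
  define PB where "PB B = ?G \<inter> {p. \<forall>v. v \<notin> B \<longrightarrow> snd p $ v = 0}" for B :: "'v set"
  define Q where "Q B e \<longleftrightarrow> 0 < e \<and> (\<forall>(l, z)\<in>PB B. (\<forall>v\<in>B. e \<le> z $ v) \<and>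
    (\<forall>w. (\<forall>v. v \<notin> B \<longrightarrow> w $ v = 0) \<longrightarrow> e * norm w \<le> norm (A l *v w)))" for B e
  have "\<exists>e. Q B e" if B: "card B = CARD('m)" for B
    unfolding Q_def
  proof (rule uniform_basis_bounds[OF _ cont])
    have "closed {p::'a \<times> (real^'v). \<forall>v. v \<notin> B \<longrightarrow> snd p $ v = 0}"
      by (intro closed_Collect_all closed_Collect_imp closed_Collect_eq continuous_intros) auto
    then show "compact (PB B)" unfolding PB_def using graph by (rule compact_Int_closed[rotated])
    fix l z assume lz: "(l, z) \<in> PB B"
    then show "lp_basis (A l) B"
      using nondegenerate_optimal_on_basis(1)[of "A l" "b l" q z B] nondeg surj B
      by (auto simp: PB_def)
    fix v assume "v \<in> B"
    then show "0 < z $ v"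
      using lz nondegenerate_optimal_on_basis(2)[of "A l" "b l" q z B] nondeg surj B
      by (auto simp: PB_def)
  qed
  then obtain E where QE: "\<And>B. card B = CARD('m) \<Longrightarrow> Q B (E B)" by metis
  have E: "0 < E B" "\<And>l z v. (l, z) \<in> PB B \<Longrightarrow> v \<in> B \<Longrightarrow> E B \<le> z $ v"
    "\<And>l z w. (l, z) \<in> PB B \<Longrightarrow> \<forall>v. v \<notin> B \<longrightarrow> w $ v = 0 \<Longrightarrow> E B * norm w \<le> norm (A l *v w)"
    if "card B = CARD('m)" for B
    using QE[OF that] unfolding Q_def by blast+
  \<comment> \<open>There are finitely many \<open>B\<close>, so one constant serves them all. The
    element 1 only keeps the set nonempty for \<open>Min\<close>.\<close>
  define e where "e = Min (insert 1 (E ` {B. card B = CARD('m)}))"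
  have e0: "0 < e" unfolding e_def using E(1) by auto
  have eE: "e \<le> E B" if "card B = CARD('m)" for B
    unfolding e_def using that by (intro Min_le) auto
  obtain R where R: "\<And>l z. (l, z) \<in> ?G \<Longrightarrow> norm z \<le> R" "0 < R"
  proof -
    obtain R where "R > 0" "\<forall>p\<in>?G. norm p \<le> R"
      using graph compact_imp_bounded bounded_pos by blast
    then show thesis using that[of R] norm_snd_le order_trans by (metis (no_types, lifting) snd_conv)
  qed
  obtain C where C: "0 < C" "\<And>d z. norm (D d z) \<le> C * norm d * norm z"
    "\<And>d. norm (\<beta> d) \<le> C * norm d"
  proof -
    obtain C1 where C1: "0 < C1" "\<And>d z. norm (D d z) \<le> norm d * norm z * C1"
      using bounded_bilinear.pos_bounded[OF D] by blast
    obtain C2 where C2: "0 < C2" "\<And>d. norm (\<beta> d) \<le> norm d * C2"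
      using bounded_linear.pos_bounded[OF \<beta>] by blast
    show thesis
    proof (rule that[of "C1 + C2"])
      show "0 < C1 + C2" using C1 C2 by simp
      show "norm (D d z) \<le> (C1 + C2) * norm d * norm z" for d z
      proof -
        have "0 \<le> C2 * norm d * norm z" using C2(1) by simp
        then show ?thesis using C1(2)[of d z] by (simp add: algebra_simps)
      qed
      show "norm (\<beta> d) \<le> (C1 + C2) * norm d" for d
      proof -
        have "0 \<le> C1 * norm d" using C1(1) by simp
        then show ?thesis using C2(2)[of d] by (simp add: algebra_simps)
      qed
    qed
  qed
  define r where "r = min (e / (2 * C)) (e\<^sup>2 / (2 * C * (1 + R)))"
  have r: "0 < r" unfolding r_def using e0 C(1) R(2) by simp
  define L where "L = norm q * (C * (1 + R) / e)"
  define K where "K = norm q * (2 * C\<^sup>2 * (1 + R) / e\<^sup>2)"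
  have L: "0 \<le> L" and K: "0 \<le> K" unfolding L_def K_def using e0 C(1) R(2) by auto
  have fbound: "\<bar>f l\<bar> \<le> norm q * R" if l: "l \<in> \<Lambda>" for l
  proof -
    obtain z where z: "std_optimal (A l) (b l) q z" using ex[OF l] by blast
    then have "norm z \<le> R" using l by (intro R(1)[of l]) auto
    then have "norm q * norm z \<le> norm q * R" by (intro mult_left_mono) auto
    then show ?thesis using f[OF l z] Cauchy_Schwarz_ineq2[of q z] by simp
  qed
  \<comment> \<open>For \<open>norm d > r\<close> the second term pays for
    \<open>\<bar>f y - f x\<bar>\<close>, at most \<open>2 * (norm q * R)\<close>, and the third for
    \<open>- g d\<close>, at most \<open>L * norm d\<close>.\<close>
  define K' where "K' = K + 2 * (norm q * R) / r\<^sup>2 + L / r"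
  have qR: "0 \<le> norm q * R" using R(2) by simp
  have K': "K \<le> K'" "0 \<le> K'" unfolding K'_def using K L r qR by auto
  show ?thesis
  proof (rule weakly_concave_on_if_quadratic_upper_support[OF \<Lambda> K'(2)])
    fix x assume x: "x \<in> \<Lambda>"
    obtain z0 where "std_optimal (A x) (b x) q z0" using ex[OF x] by blast
    then obtain z B where z: "std_optimal (A x) (b x) q z" "basic_solution_for (A x) B z"
      using optimal_basic_solution_exists surj[OF x] by metis
    have B: "card B = CARD('m)" "\<And>v. v \<notin> B \<Longrightarrow> z $ v = 0"
      using z(2) by (auto simp: basic_solution_for_def lp_basis_def)
    have xz: "(x, z) \<in> PB B" using x z(1) B(2) by (auto simp: PB_def)
    have Az: "A x *v z = b x" using z(1) by (simp add: std_optimal_def std_feasible_def)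
    have low: "e * norm w \<le> norm (A x *v w)" if "\<forall>v. v \<notin> B \<longrightarrow> w $ v = 0" for w
      using E(3)[OF B(1) xz that] eE[OF B(1)] by (meson mult_right_mono norm_ge_zero order_trans)
    have zB: "e \<le> z $ v" if "v \<in> B" for v
      using E(2)[OF B(1) xz that] eE[OF B(1)] by simp
    have zR: "norm z \<le> R" using x z(1) by (intro R(1)[of x]) auto
    obtain g where g: "linear g" "\<And>d. norm (g d) \<le> L * norm d"
      "\<And>d. norm d \<le> r \<Longrightarrow> \<exists>z'. A x *v z' + D d z' = b x + \<beta> d \<and> (\<forall>v. 0 \<le> z' $ v) \<and>
        q \<bullet> z' \<le> q \<bullet> z + g d + K * (norm d)\<^sup>2"
      using perturbed_basic_solution[OF D \<beta> C B(1) e0 low Az B(2) zB zR, of q]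
      unfolding L_def K_def r_def by metis
    show "\<exists>g. linear g \<and> (\<forall>y\<in>\<Lambda>. f y \<le> f x + g (y - x) + K' * (norm (y - x))\<^sup>2)"
    proof (intro exI[of _ g] conjI g(1) ballI)
      fix y assume y: "y \<in> \<Lambda>"
      let ?d = "y - x"
      show "f y \<le> f x + g ?d + K' * (norm ?d)\<^sup>2"
      proof (cases "norm ?d \<le> r")
        case True
        then obtain z' where z': "A x *v z' + D ?d z' = b x + \<beta> ?d" "\<forall>v. 0 \<le> z' $ v"
          "q \<bullet> z' \<le> q \<bullet> z + g ?d + K * (norm ?d)\<^sup>2"
          using g(3) by blast
        obtain zy where zy: "std_optimal (A y) (b y) q zy" using ex[OF y] by blast
        \<comment> \<open>The perturbed solution need not be optimal at \<open>y\<close>;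
          feasibility is enough for an upper bound on \<open>f y\<close>.\<close>
        have "std_feasible (A y) (b y) z'"
          using z' by (simp add: std_feasible_def A[where l = x and l' = y] b[where l = x and l' = y])
        then have "f y \<le> q \<bullet> z'" using zy f[OF y zy] by (simp add: std_optimal_def)
        also have "\<dots> \<le> f x + g ?d + K * (norm ?d)\<^sup>2" using z'(3) f[OF x z(1)] by simp
        also have "\<dots> \<le> f x + g ?d + K' * (norm ?d)\<^sup>2" using K'(1) by (simp add: mult_right_mono)
        finally show ?thesis .
      next
        case False
        then have rd: "1 \<le> norm ?d / r" using r by simp
        have "2 * (norm q * R) * 1 \<le> 2 * (norm q * R) * (norm ?d / r)\<^sup>2"
          using rd qR by (intro mult_left_mono one_le_power) auto
        moreover have "L * norm ?d * 1 \<le> L * norm ?d * (norm ?d / r)"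
          using rd L by (intro mult_left_mono) auto
        moreover have "0 \<le> K * (norm ?d)\<^sup>2" using K by simp
        moreover have "K' * (norm ?d)\<^sup>2 = K * (norm ?d)\<^sup>2 + 2 * (norm q * R) * (norm ?d / r)\<^sup>2
            + L * norm ?d * (norm ?d / r)"
          unfolding K'_def by (simp add: power2_eq_square algebra_simps)
        ultimately show ?thesis
          using g(2)[of ?d] fbound[OF x] fbound[OF y] unfolding real_norm_def by linarith
      qed
    qed
  qed
qed

subsection \<open>The standard form as a parametric linear program\<close>

lemma std_matrix_mult_balance:
  fixes l :: "real^'n::finite"
  shows "(std_matrix \<theta> l *v z) $ balance_eqn k =
      (\<Sum>j\<in>UNIV. z $ x_var j k) + (\<Sum>j\<in>UNIV. z $ x_var k j) + z $ y_var k"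
proof -
  have pull: "(\<Sum>j\<in>UNIV. if P then g j else 0) = (if P then \<Sum>j\<in>UNIV. g j else 0)"
    for P and g :: "'n \<Rightarrow> real" by simp
  show ?thesis
    by (simp add: matrix_vector_mult_def std_matrix_def sum_UNIV_Plus sum_UNIV_Times
        distrib_right sum.distrib of_bool_def if_distrib[of "\<lambda>t. t * _"]
        pull cong: if_cong)
qed

lemma std_matrix_mult_ratio:
  fixes l :: "real^'n::finite"
  shows "(std_matrix \<theta> l *v z) $ ratio_eqn i j =
      \<theta> i * z $ x_var i j - l $ j * z $ y_var i + z $ slack_var i j"
proof -
  have pull: "(\<Sum>j\<in>UNIV. if P then g j else 0) = (if P then \<Sum>j\<in>UNIV. g j else 0)"
    for P and g :: "'n \<Rightarrow> real" by simp
  have ite: "(if i = a \<and> j = b then t else 0) = (if i = a then (if j = b then t else 0) else 0)"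
    for i a j b :: 'n and t :: real by simp
  show ?thesis
    by (simp add: matrix_vector_mult_def std_matrix_def sum_UNIV_Plus sum_UNIV_Times
        of_bool_def if_distrib[of "\<lambda>t. t * _"] ite pull cong: if_cong)
qed

text \<open>The part of the matrix that varies with \<open>l\<close>: the parameter enters only the
  \<open>y_var\<close> columns of the ratio equations, and linearly, so the shift is exact for every
  \<open>d\<close>.\<close>

definition ratio_perturbation :: "real^'n \<Rightarrow> real^'n lp_var \<Rightarrow> real^('n::finite) lp_eqn" where
  "ratio_perturbation d z =
     (\<chi> r. case r of balance_eqn k \<Rightarrow> 0 | ratio_eqn i j \<Rightarrow> - (d $ j * z $ y_var i))"

lemma bounded_bilinear_ratio_perturbation: "bounded_bilinear ratio_perturbation"
  unfolding bilinear_conv_bounded_bilinear[symmetric] bilinear_def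
  by (auto intro!: linearI simp: ratio_perturbation_def vec_eq_iff algebra_simps split: sum.split)

lemma std_matrix_mult_shift:
  "std_matrix \<theta> l' *v z = std_matrix \<theta> l *v z + ratio_perturbation (l' - l) z"
  unfolding vec_eq_iff split_sum_all split_paired_All
  by (simp add: std_matrix_mult_balance std_matrix_mult_ratio ratio_perturbation_def algebra_simps)

lemma bounded_linear_std_rhs: "bounded_linear std_rhs"
  unfolding linear_conv_bounded_linear[symmetric]
  by (rule linearI) (auto simp: std_rhs_def vec_eq_iff split: sum.split)

text \<open>The \<open>y\<close> and slack columns form a triangular system: \<open>y\<close> meets
  the balance equations, then each slack settles its own ratio equation.\<close>

lemma surj_std_matrix: "surj ((*v) (std_matrix \<theta> l))"
proof (rule surjI)
  show "std_matrix \<theta> l *v (\<chi> v. case v of x_var i j \<Rightarrow> 0 | y_var i \<Rightarrow> u $ balance_eqn i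
     | slack_var i j \<Rightarrow> u $ ratio_eqn i j + l $ j * u $ balance_eqn i) = u" for u
    unfolding vec_eq_iff split_sum_all split_paired_All
    by (simp add: std_matrix_mult_balance std_matrix_mult_ratio)
qed

section \<open>Correspondence between the program and its standard form\<close>

lemma lp_feasible_of_std:
  assumes "std_feasible (std_matrix \<theta> l) (std_rhs l) z"
  shows "lp_feasible \<theta> l (\<lambda>i j. z $ x_var i j) (\<lambda>i. z $ y_var i)"
proof -
  have "\<theta> i * z $ x_var i j \<le> l $ j * z $ y_var i" for i j
  proof -
    have "\<theta> i * z $ x_var i j + z $ slack_var i j = l $ j * z $ y_var i" "0 \<le> z $ slack_var i j"
      using assms unfolding std_feasible_iff by blast+
    then show ?thesis by linarith
  qed
  then show ?thesis using assms unfolding std_feasible_iff lp_feasible_def by blast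
qed

lemma std_of_lp_feasible:
  assumes "lp_feasible \<theta> l x y"
  obtains z where "std_feasible (std_matrix \<theta> l) (std_rhs l) z"
    "std_cost c1 c2 \<bullet> z = lp_objective c1 c2 x y"
proof
  define z where "z = (\<chi> v. case v of x_var i j \<Rightarrow> x i j | y_var i \<Rightarrow> y i
     | slack_var i j \<Rightarrow> l $ j * y i - \<theta> i * x i j)"
  show "std_feasible (std_matrix \<theta> l) (std_rhs l) z"
    using assms unfolding std_feasible_iff lp_feasible_def split_sum_all split_paired_All z_def
    by simp
  show "std_cost c1 c2 \<bullet> z = lp_objective c1 c2 x y"
    unfolding inner_std_cost by (simp add: z_def)
qed

text \<open>Slacks cost nothing and are determined by \<open>x\<close> and \<open>y\<close>, so
  competitors may be taken in the original variables, where they are easier to rescale.\<close>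

lemma std_optimal_iff:
  "std_optimal (std_matrix \<theta> l) (std_rhs l) (std_cost c1 c2) z \<longleftrightarrow>
     std_feasible (std_matrix \<theta> l) (std_rhs l) z \<and>
     (\<forall>x y. lp_feasible \<theta> l x y \<longrightarrow> std_cost c1 c2 \<bullet> z \<le> lp_objective c1 c2 x y)"
  unfolding std_optimal_def
  by (metis std_of_lp_feasible lp_feasible_of_std inner_std_cost)

lemma opt_value_eq:
  assumes "std_optimal (std_matrix \<theta> l) (std_rhs l) (std_cost c1 c2) z"
  shows "opt_value c1 c2 \<theta> l = std_cost c1 c2 \<bullet> z"
  unfolding opt_value_def
proof (rule cInf_eq_minimum)
  show "std_cost c1 c2 \<bullet> z \<in> {lp_objective c1 c2 x y |x y. lp_feasible \<theta> l x y}"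
    using assms lp_feasible_of_std inner_std_cost unfolding std_optimal_def by blast
  show "std_cost c1 c2 \<bullet> z \<le> v" if "v \<in> {lp_objective c1 c2 x y |x y. lp_feasible \<theta> l x y}" for v
    using assms that unfolding std_optimal_iff by blast
qed

section \<open>Compactness of the set of optimal pairs\<close>

text \<open>Scaling \<open>x\<close> by \<open>t\<^sup>2\<close> rather than \<open>t\<close> leaves a factor \<open>t\<close> in \<open>y\<close> for the
  ratio constraints, where \<open>l'\<close> enters as a coefficient.\<close>

lemma lp_feasible_rescale:
  assumes feas: "lp_feasible \<theta> l x y" and l: "\<And>i. 0 \<le> l $ i"
    and t: "0 \<le> t" "t \<le> 1" "\<And>i. t * l $ i \<le> l' $ i"
  shows "lp_feasible \<theta> l' (\<lambda>i j. t\<^sup>2 * x i j) (\<lambda>i. l' $ i - t\<^sup>2 * (l $ i - y i))"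
proof -
  have bal: "(\<Sum>j\<in>UNIV. x j i) + (\<Sum>j\<in>UNIV. x i j) + y i = l $ i"
    and rat: "\<theta> i * x i j \<le> l $ j * y i" and x0: "0 \<le> x i j" and y0: "0 \<le> y i" for i j
    using feas unfolding lp_feasible_def by blast+
  have yl: "y i \<le> l $ i" for i
  proof -
    have "0 \<le> (\<Sum>j\<in>UNIV. x j i)" "0 \<le> (\<Sum>j\<in>UNIV. x i j)" by (intro sum_nonneg x0)+
    then show ?thesis using bal[of i] by linarith
  qed
  \<comment> \<open>Since \<open>t * l $ i \<le> l' $ i\<close>, the right-hand side is at least
    \<open>t * (1 - t) * l $ i + t\<^sup>2 * y i\<close>, and
    \<open>y i \<le> l $ i\<close>.\<close>
  have ty: "t * y i \<le> l' $ i - t\<^sup>2 * (l $ i - y i)" for i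
  proof -
    have "t * (1 - t) * y i \<le> t * (1 - t) * l $ i" using t yl by (intro mult_left_mono) auto
    then show ?thesis using t(3)[of i] by (simp add: power2_eq_square algebra_simps)
  qed
  show ?thesis
    unfolding lp_feasible_def
  proof (intro conjI allI)
    fix i j
    have "l $ i - y i = (\<Sum>j\<in>UNIV. x j i) + (\<Sum>j\<in>UNIV. x i j)" using bal[of i] by simp
    then show "(\<Sum>j\<in>UNIV. t\<^sup>2 * x j i) + (\<Sum>j\<in>UNIV. t\<^sup>2 * x i j) + (l' $ i - t\<^sup>2 * (l $ i - y i)) = l' $ i"
      by (simp add: sum_distrib_left[symmetric] distrib_left)
    have "\<theta> i * (t\<^sup>2 * x i j) = t\<^sup>2 * (\<theta> i * x i j)" by simp
    also have "\<dots> \<le> t\<^sup>2 * (l $ j * y i)" using rat by (intro mult_left_mono) auto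
    also have "\<dots> = (t * l $ j) * (t * y i)" by (simp add: power2_eq_square)
    also have "\<dots> \<le> l' $ j * (l' $ i - t\<^sup>2 * (l $ i - y i))"
      using t l y0 ty by (intro mult_mono order_trans[OF _ t(3)]) auto
    finally show "\<theta> i * (t\<^sup>2 * x i j) \<le> l' $ j * (l' $ i - t\<^sup>2 * (l $ i - y i))" .
    show "0 \<le> t\<^sup>2 * x i j" using x0 by simp
    show "0 \<le> l' $ i - t\<^sup>2 * (l $ i - y i)" using ty[of i] t(1) y0[of i] by (meson mult_nonneg_nonneg order_trans)
  qed
qed

lemma closed_std_feasible:
  "closed {(l, z). std_feasible (std_matrix \<theta> l) (std_rhs l) z}"
  unfolding std_feasible_iff split_beta
  by (intro closed_Collect_conj closed_Collect_all closed_Collect_eq closed_Collect_le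
      continuous_intros)

text \<open>The balance equations bound \<open>x\<close> and \<open>y\<close> by \<open>l\<close>,
  and the ratio equations then bound the slacks because \<theta> is nonnegative. The bound involves
  only \<open>hi\<close>, so it is uniform over the box.\<close>

lemma std_feasible_norm_bound:
  fixes l hi :: "real^'n::finite"
  assumes feas: "std_feasible (std_matrix \<theta> l) (std_rhs l) z"
    and l: "\<And>i. 0 \<le> l $ i" "l \<le> hi" and \<theta>: "\<And>i. 0 \<le> \<theta> i"
  shows "norm z \<le> real CARD('n lp_var) * (norm hi + norm hi * norm hi)"
proof -
  have bal: "(\<Sum>j\<in>UNIV. z $ x_var j i) + (\<Sum>j\<in>UNIV. z $ x_var i j) + z $ y_var i = l $ i"
    and rat: "\<theta> i * z $ x_var i j + z $ slack_var i j = l $ j * z $ y_var i" and z0: "0 \<le> z $ v" for i j v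
    using feas unfolding std_feasible_iff by blast+
  have lhi: "l $ i \<le> norm hi" for i
    using l(2) component_le_norm_cart[of hi i] by (auto simp: less_eq_vec_def intro: order_trans)
  have xs: "0 \<le> (\<Sum>j\<in>UNIV. z $ x_var j i)" "0 \<le> (\<Sum>j\<in>UNIV. z $ x_var i j)" for i
    by (intro sum_nonneg z0)+
  have yb: "z $ y_var i \<le> norm hi" for i using bal[of i] xs[of i] lhi[of i] by linarith
  have hh: "0 \<le> norm hi * norm hi" by simp
  have xb: "z $ x_var i j \<le> norm hi" for i j
  proof -
    have "z $ x_var i j \<le> (\<Sum>j\<in>UNIV. z $ x_var i j)" using z0 by (intro member_le_sum) auto
    then show ?thesis using bal[of i] xs(1)[of i] z0[of "y_var i"] lhi[of i] by linarith
  qed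
  have sb: "z $ slack_var i j \<le> norm hi * norm hi" for i j
  proof -
    have "l $ j * z $ y_var i \<le> norm hi * norm hi" using lhi yb z0 l(1) by (intro mult_mono) auto
    moreover have "0 \<le> \<theta> i * z $ x_var i j" using \<theta> z0 by simp
    ultimately show ?thesis using rat[of i j] by linarith
  qed
  have "\<forall>v. z $ v \<le> norm hi + norm hi * norm hi"
    unfolding split_sum_all split_paired_All
    using xb yb sb hh by (auto intro: add_increasing add_increasing2)
  then have "\<bar>z $ v\<bar> \<le> norm hi + norm hi * norm hi" for v using z0[of v] by simp
  then have "(\<Sum>v\<in>UNIV. \<bar>z $ v\<bar>) \<le> real CARD('n lp_var) * (norm hi + norm hi * norm hi)"
    by (intro sum_bounded_above)
  then show ?thesis using norm_le_l1_cart order_trans by blast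
qed

lemma std_optimal_exists:
  fixes l :: "real^'n::finite"
  assumes l: "\<And>i. 0 \<le> l $ i" and \<theta>: "\<And>i. 0 \<le> \<theta> i"
  shows "\<exists>z. std_optimal (std_matrix \<theta> l) (std_rhs l) (std_cost c1 c2) z"
proof -
  let ?F = "{z. std_feasible (std_matrix \<theta> l) (std_rhs l) z}"
  have "closed ?F"
    unfolding std_feasible_iff
    by (intro closed_Collect_conj closed_Collect_all closed_Collect_eq closed_Collect_le
        continuous_intros)
  moreover have "bounded ?F"
    using std_feasible_norm_bound[where \<theta> = \<theta>, OF _ l order_refl \<theta>]
    unfolding bounded_iff by blast
  ultimately have "compact ?F" by (simp add: compact_eq_bounded_closed)
  moreover have "?F \<noteq> {}"
  proof -
    have "lp_feasible \<theta> l (\<lambda>i j. 0) (($) l)" using l by (simp add: lp_feasible_def)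
    then show ?thesis using std_of_lp_feasible by blast
  qed
  moreover have "continuous_on ?F ((\<bullet>) (std_cost c1 c2))" by (intro continuous_intros)
  ultimately show ?thesis
    using continuous_attains_inf[of ?F "(\<bullet>) (std_cost c1 c2)"] unfolding std_optimal_def by blast
qed

text \<open>Optimality passes to the limit because any competitor at the limit \<open>l\<close>,
  rescaled by \<open>t < 1\<close>, is feasible at all parameters close to \<open>l\<close>. One
  lets the sequence converge for fixed \<open>t\<close>, and only then \<open>t\<close> tend to
  1.\<close>

lemma compact_std_optimal_graph:
  fixes lo hi :: "real^'n::finite"
  assumes lo: "\<And>i. 0 < lo $ i" and \<theta>: "\<And>i. 0 \<le> \<theta> i"
  shows "compact {(l, z). l \<in> {lo..hi} \<and> std_optimal (std_matrix \<theta> l) (std_rhs l) (std_cost c1 c2) z}"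
    (is "compact ?G")
proof -
  have lpos: "0 < l $ i" if "l \<in> {lo..hi}" for l i
    using lo[of i] that by (auto simp: less_eq_vec_def intro: less_le_trans)
  have "bounded ?G"
  proof (rule bounded_subset)
    let ?M = "real CARD('n lp_var) * (norm hi + norm hi * norm hi)"
    show "bounded ({lo..hi} \<times> cball 0 ?M :: ((real^'n) \<times> (real^'n lp_var)) set)"
      by (intro bounded_Times bounded_closed_interval bounded_cball)
    show "?G \<subseteq> {lo..hi} \<times> cball 0 ?M"
      using std_feasible_norm_bound[where \<theta> = \<theta> and hi = hi, OF _ less_imp_le[OF lpos] _ \<theta>]
      by (auto simp: std_optimal_def)
  qed
  moreover have "closed ?G"
    unfolding closed_sequential_limits
  proof (intro allI impI, elim conjE)
    fix s p assume sG: "\<forall>n. s n \<in> ?G" and lim: "s \<longlonglongrightarrow> p"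
    obtain l z where p: "p = (l, z)" by (cases p)
    let ?q = "std_cost c1 c2"
    have sl: "(\<lambda>n. fst (s n)) \<longlonglongrightarrow> l" and sz: "(\<lambda>n. snd (s n)) \<longlonglongrightarrow> z"
      using tendsto_fst[OF lim] tendsto_snd[OF lim] p by auto
    have opt: "std_optimal (std_matrix \<theta> (fst (s n))) (std_rhs (fst (s n))) ?q (snd (s n))"
      and sbox: "fst (s n) \<in> {lo..hi}" for n
      using sG by (auto simp: split_beta)
    have l: "l \<in> {lo..hi}"
      using closed_cbox[of lo hi] sbox sl unfolding cbox_interval by (rule closed_sequentially)
    have "(l, z) \<in> {(l, z). std_feasible (std_matrix \<theta> l) (std_rhs l) z}"
    proof (rule closed_sequentially[OF closed_std_feasible])
      show "s n \<in> {(l, z). std_feasible (std_matrix \<theta> l) (std_rhs l) z}" for n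
        using opt[of n] by (simp add: std_optimal_def split_beta)
      show "s \<longlonglongrightarrow> (l, z)" using lim p by simp
    qed
    then have feas: "std_feasible (std_matrix \<theta> l) (std_rhs l) z" by simp
    have "?q \<bullet> z \<le> lp_objective c1 c2 x y" if xy: "lp_feasible \<theta> l x y" for x y
    proof -
      let ?ob = "\<lambda>l' t. lp_objective c1 c2 (\<lambda>i j. t\<^sup>2 * x i j) (\<lambda>i. l' $ i - t\<^sup>2 * (l $ i - y i))"
      have le: "?q \<bullet> z \<le> ?ob l t" if t: "0 < t" "t < 1" for t
      proof (rule tendsto_le)
        show "(\<lambda>n. ?ob (fst (s n)) t) \<longlonglongrightarrow> ?ob l t"
          unfolding lp_objective_def by (intro tendsto_intros sl)
        show "(\<lambda>n. ?q \<bullet> snd (s n)) \<longlonglongrightarrow> ?q \<bullet> z" by (intro tendsto_intros sz)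
        \<comment> \<open>Positivity of \<open>l\<close> makes \<open>t * l $ i < l $ i\<close>
          strict, which leaves room for the sequence.\<close>
        have "\<forall>\<^sub>F n in sequentially. t * l $ i < fst (s n) $ i" for i
          using lpos[OF l, of i] t by (intro order_tendstoD(1)[OF tendsto_vec_nth[OF sl]]) auto
        then have "\<forall>\<^sub>F n in sequentially. \<forall>i. t * l $ i < fst (s n) $ i"
          by (simp add: eventually_all_finite)
        then show "\<forall>\<^sub>F n in sequentially. ?q \<bullet> snd (s n) \<le> ?ob (fst (s n)) t"
        proof eventually_elim
          case (elim n)
          have "lp_feasible \<theta> (fst (s n)) (\<lambda>i j. t\<^sup>2 * x i j)
              (\<lambda>i. fst (s n) $ i - t\<^sup>2 * (l $ i - y i))"
            using xy elim t lpos[OF l] by (intro lp_feasible_rescale) (auto intro: less_imp_le)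
          then show ?case using opt[of n] unfolding std_optimal_iff by blast
        qed
      qed simp
      \<comment> \<open>At \<open>t = 1\<close> the rescaled competitor is \<open>x\<close>,
        \<open>y\<close> itself, since \<open>l $ i - (l $ i - y i) = y i\<close>.\<close>
      have "continuous_on UNIV (?ob l)"
        unfolding lp_objective_def by (intro continuous_intros)
      then have "isCont (?ob l) 1" by (simp only: continuous_on_eq_continuous_at open_UNIV UNIV_I)
      then have "(?ob l \<longlongrightarrow> ?ob l 1) (at_left 1)"
        unfolding isCont_def filterlim_at_split by (rule conjunct1)
      moreover have "\<forall>\<^sub>F t in at_left (1::real). ?q \<bullet> z \<le> ?ob l t"
        using eventually_at_left_real[of 0 1] by (auto elim!: eventually_mono intro: le)
      ultimately have "?q \<bullet> z \<le> ?ob l 1" by (intro tendsto_lowerbound) auto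
      then show ?thesis by simp
    qed
    then show "p \<in> ?G" using feas l by (auto simp: p std_optimal_iff)
  qed
  ultimately show ?thesis by (simp add: compact_eq_bounded_closed)
qed

section \<open>Weak concavity of the optimal value on the box\<close>

theorem lemma1:
  fixes c1 :: "'n::finite \<Rightarrow> real" and c2 :: "'n \<Rightarrow> 'n \<Rightarrow> real"
    and \<theta> :: "'n \<Rightarrow> real" and lo hi :: "real^'n"
  assumes "\<And>i. 0 < c1 i" and "\<And>i j. 0 < c2 i j"
    and "\<And>i. c1 i = c2 i i" and "\<And>i j. c1 i \<le> c2 i j" and "\<And>i j. c2 i j = c2 j i"
    and "\<And>i. 0 \<le> \<theta> i"
    and "\<And>i. 0 < lo $ i"
    and "\<And>l z. l \<in> {lo..hi} \<Longrightarrow>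
           basic_feasible_solution (std_matrix \<theta> l) (std_rhs l) z \<Longrightarrow>
           std_optimal (std_matrix \<theta> l) (std_rhs l) (std_cost c1 c2) z \<Longrightarrow>
           nondegenerate (std_matrix \<theta> l) z"
  shows "weakly_concave_on {lo..hi} (opt_value c1 c2 \<theta>)"
proof (rule parametric_lp_weakly_concave)
  show "convex {lo..hi}" using convex_box(1)[of lo hi] by (simp add: cbox_interval)
  show "compact {(l, z). l \<in> {lo..hi} \<and>
      std_optimal (std_matrix \<theta> l) (std_rhs l) (std_cost c1 c2) z}"
    using assms(7,6) by (rule compact_std_optimal_graph)
  show "\<exists>z. std_optimal (std_matrix \<theta> l) (std_rhs l) (std_cost c1 c2) z" if "l \<in> {lo..hi}" for l
  proof (rule std_optimal_exists)
    show "0 \<le> l $ i" for i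
      using assms(7)[of i] that by (auto simp: less_eq_vec_def intro: less_imp_le less_le_trans)
  qed (rule assms(6))
  show "std_rhs l' = std_rhs l + std_rhs (l' - l)" for l l' :: "real^'n"
    using linear_add[OF bounded_linear.linear[OF bounded_linear_std_rhs], of l "l' - l"] by simp
qed (rule surj_std_matrix std_matrix_mult_shift bounded_bilinear_ratio_perturbation
    bounded_linear_std_rhs assms(8) opt_value_eq; assumption)+

end
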